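(* Let $\mathcal F:\mathscr P^r(\mathcal X)^{\otimes m}\to\mathbb R$ be a lower semi-continuous, jointly linearly convex functional whose first variations exist, let $\rho^0=(\rho_1^0,\dots,\rho_m^0)\in\mathscr P^r(\mathcal X)^{\otimes m}$, let $K\ge1$, and let $\eta_1,\dots,\eta_K>0$ be step sizes. Assume that for every $k\in[K]$ and $j\in[m]$ the solution of $$\rho_j^k=\operatorname*{argmin}_{\rho_j\in\mathscr P^r(\mathcal X)}\ \int_{\mathcal X}\frac{\delta\mathcal F}{\delta\rho_j}(\rho^{k-1})\,d(\rho_j-\rho_j^{k-1})+\frac1{\eta_k}D_{\mathrm{KL}}(\rho_j\,\|\,\rho_j^{k-1})$$ exists, where $\rho^{k}=(\rho_1^{k},\dots,\rho_m^{k})$ (all coordinates are updated in parallel). Suppose there are constants $L_j\ge0$, $j\in[m]$, such that $$\sup_{\rho\in\mathscr P^r(\mathcal X)^{\otimes m}}\Big\|\frac{\delta\mathcal F}{\delta\rho_j}(\rho)\Big\|_{L^\infty(\mathcal X)}\le L_j .$$ Then for every $\rho\in\mathscr P_2^r(\mathcal X)^{\otimes m}$, $$\min_{0\le k\le K-1}\mathcal F(\rho^k)-\mathcal F(\rho)\le\frac{D_{\mathrm{KL}}(\rho\,\|\,\rho^0)}{\eta_1+\dots+\eta_K}+\frac{\sum_{k=1}^K\eta_k^2\sum_{j=1}^mL_j^2}{2(\eta_1+\dots+\eta_K)} .$$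
   Context: $\mathcal X\subset\mathbb R^d$ is the state space, $\mathscr P^r(\mathcal X)$ is the set of absolutely continuous probability distributions on $\mathcal X$, and $\mathscr P^r_2(\mathcal X)$ those with finite second moment. For $\rho=(\rho_1,\dots,\rho_m)$ and $\rho'=(\rho'_1,\dots,\rho'_m)$, $D_{\mathrm{KL}}(\rho\,\|\,\rho')=\sum_{j=1}^mD_{\mathrm{KL}}(\rho_j\,\|\,\rho'_j)$ (the KL divergence of the product measures). The first variation of $\mathcal F$ at $\rho$ with respect to the $j$-th coordinate is a map $\frac{\delta\mathcal F}{\delta\rho_j}(\rho):\mathcal X\to\mathbb R$ such that for every $\chi_j=\rho_j'-\rho_j$ with $\rho_j'\in\mathscr P^r(\mathcal X)$, $$\frac{d}{d\varepsilon}\mathcal F(\rho_1,\dots,\rho_j+\varepsilon\chi_j,\dots,\rho_m)\Big|_{\varepsilon=0}=\int_{\mathcal X}\frac{\delta\mathcal F}{\delta\rho_j}(\rho)\,d\chi_j .$$ $\mathcal F$ is jointly linearly convex if for all $\rho,\rho'\in\mathscr P^r(\mathcal X)^{\otimes m}$, $$\mathcal F(\rho_1',\dots,\rho_m')\ge\mathcal F(\rho_1,\dots,\rho_m)+\sum_{j=1}^m\int_{\mathcal X}\frac{\delta\mathcal F}{\delta\rho_j}(\rho)(x_j)\,d(\rho_j'-\rho_j).$$ *)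

theory Defs
  imports "HOL-Probability.Probability"
begin

text \<open>
  A distribution on a Borel set \<open>X\<close> is a measure on the trace Borel sigma-algebra of \<open>X\<close>; the
  reference measure \<open>restrict_space lborel X\<close> is Lebesgue measure on \<open>X\<close>.
\<close>

definition ac_prob :: "'a::euclidean_space set \<Rightarrow> 'a measure set" where
  "ac_prob X = {\<mu>. prob_space \<mu> \<and> sets \<mu> = sets (restrict_space borel X) \<and>
                   absolutely_continuous (restrict_space lborel X) \<mu>}"

definition ac_prob2 :: "'a::euclidean_space set \<Rightarrow> 'a measure set" where
  "ac_prob2 X = {\<mu> \<in> ac_prob X. integrable \<mu> (\<lambda>x. (norm x)\<^sup>2)}"

text \<open>
  The library's \<open>KL_divergence b M N\<close> has the reference measure \<open>M\<close> first, is real-valued, and is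
  \<open>0\<close> when the log-density is not integrable. For probability measures the negative part of the
  log-density is always \<open>\<mu>\<close>-integrable, so non-integrability means that the divergence is \<open>\<infinity>\<close>.
\<close>

definition KL :: "'a measure \<Rightarrow> 'a measure \<Rightarrow> ereal" where
  "KL \<mu> \<nu> = (if absolutely_continuous \<nu> \<mu> \<and> integrable \<mu> (entropy_density (exp 1) \<nu> \<mu>)
             then ereal (KL_divergence (exp 1) \<nu> \<mu>) else \<infinity>)"

definition KL_tuple :: "('m::finite \<Rightarrow> 'a measure) \<Rightarrow> ('m \<Rightarrow> 'a measure) \<Rightarrow> ereal" where
  "KL_tuple \<rho> \<rho>' = (\<Sum>j\<in>UNIV. KL (\<rho> j) (\<rho>' j))"

text \<open>The measure \<open>\<mu> + \<epsilon> (\<nu> - \<mu>)\<close>, for \<open>0 \<le> \<epsilon> \<le> 1\<close>.\<close>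

definition mixture :: "real \<Rightarrow> 'a measure \<Rightarrow> 'a measure \<Rightarrow> 'a measure" where
  "mixture \<epsilon> \<mu> \<nu> = measure_of (space \<mu>) (sets \<mu>)
     (\<lambda>A. ennreal (1 - \<epsilon>) * emeasure \<mu> A + ennreal \<epsilon> * emeasure \<nu> A)"

lemma sets_mixture [simp]: "sets (mixture \<epsilon> \<mu> \<nu>) = sets \<mu>"
  by (simp add: mixture_def)

lemma space_mixture [simp]: "space (mixture \<epsilon> \<mu> \<nu>) = space \<mu>"
  by (simp add: mixture_def)

lemma emeasure_mixture:
  assumes "sets \<nu> = sets \<mu>" "A \<in> sets \<mu>"
  shows "emeasure (mixture \<epsilon> \<mu> \<nu>) A = ennreal (1 - \<epsilon>) * emeasure \<mu> A + ennreal \<epsilon> * emeasure \<nu> A"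
proof (rule emeasure_measure_of[OF mixture_def])
  show "countably_additive (sets (mixture \<epsilon> \<mu> \<nu>))
     (\<lambda>A. ennreal (1 - \<epsilon>) * emeasure \<mu> A + ennreal \<epsilon> * emeasure \<nu> A)"
  proof (rule countably_additiveI)
    fix B :: "nat \<Rightarrow> 'a set"
    assume B: "range B \<subseteq> sets (mixture \<epsilon> \<mu> \<nu>)" "disjoint_family B"
    then have "(\<Sum>i. emeasure \<mu> (B i)) = emeasure \<mu> (\<Union>i. B i)"
      and "(\<Sum>i. emeasure \<nu> (B i)) = emeasure \<nu> (\<Union>i. B i)"
      using assms(1) by (auto intro!: suminf_emeasure)
    then show "(\<Sum>i. ennreal (1 - \<epsilon>) * emeasure \<mu> (B i) + ennreal \<epsilon> * emeasure \<nu> (B i)) =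
        ennreal (1 - \<epsilon>) * emeasure \<mu> (\<Union>i. B i) + ennreal \<epsilon> * emeasure \<nu> (\<Union>i. B i)"
      by (simp add: suminf_add[symmetric])
  qed
qed (use assms in \<open>auto simp: positive_def dest: sets.sets_into_space\<close>)

lemma mixture_in_ac_prob:
  assumes "\<mu> \<in> ac_prob X" "\<nu> \<in> ac_prob X" "0 \<le> \<epsilon>" "\<epsilon> \<le> 1"
  shows "mixture \<epsilon> \<mu> \<nu> \<in> ac_prob X"
proof -
  have sets: "sets \<nu> = sets \<mu>" and sp: "space \<nu> = space \<mu>"
    using assms by (auto simp: ac_prob_def intro!: sets_eq_imp_space_eq)
  have p: "emeasure \<mu> (space \<mu>) = 1" "emeasure \<nu> (space \<mu>) = 1"
    using assms sp prob_space.emeasure_space_1 unfolding ac_prob_def by (metis (lifting) mem_Collect_eq)+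
  have "prob_space (mixture \<epsilon> \<mu> \<nu>)"
    by (rule prob_spaceI)
       (use assms in \<open>simp add: emeasure_mixture[OF sets] p flip: ennreal_plus\<close>)
  moreover have "absolutely_continuous (restrict_space lborel X) (mixture \<epsilon> \<mu> \<nu>)"
    using assms by (auto simp: absolutely_continuous_def ac_prob_def null_sets_def subset_iff
        emeasure_mixture[OF sets])
  ultimately show ?thesis
    using assms by (simp add: ac_prob_def)
qed

definition signed_integral :: "'a measure \<Rightarrow> 'a measure \<Rightarrow> ('a \<Rightarrow> real) \<Rightarrow> real" where
  "signed_integral \<nu> \<mu> g = integral\<^sup>L \<nu> g - integral\<^sup>L \<mu> g"

text \<open>
  The curve \<open>\<epsilon> \<mapsto> F (\<rho>\<^sub>1, \<dots>, \<rho>\<^sub>j + \<epsilon> \<chi>\<^sub>j, \<dots>, \<rho>\<^sub>m)\<close> is in general only defined for \<open>\<epsilon> \<in> [0, 1]\<close>,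
  so its derivative at \<open>0\<close> is one-sided. Integrability is what makes the integral against
  \<open>\<chi>\<^sub>j\<close> meaningful. A first variation is only unique up to an additive constant
  and null sets, hence a predicate.
\<close>

definition is_first_variation ::
  "'a::euclidean_space set \<Rightarrow> (('m \<Rightarrow> 'a measure) \<Rightarrow> real) \<Rightarrow> 'm \<Rightarrow> ('m \<Rightarrow> 'a measure) \<Rightarrow>
   ('a \<Rightarrow> real) \<Rightarrow> bool" where
  "is_first_variation X F j \<rho> g \<longleftrightarrow>
     (\<forall>\<nu>\<in>ac_prob X. integrable \<nu> g \<and>
        ((\<lambda>\<epsilon>. F (\<rho>(j := mixture \<epsilon> (\<rho> j) \<nu>))) has_real_derivative signed_integral \<nu> (\<rho> j) g)
          (at 0 within {0..1}))"

definition jointly_linearly_convex ::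
  "'a::euclidean_space set \<Rightarrow> (('m::finite \<Rightarrow> 'a measure) \<Rightarrow> real) \<Rightarrow>
   ('m \<Rightarrow> ('m \<Rightarrow> 'a measure) \<Rightarrow> 'a \<Rightarrow> real) \<Rightarrow> bool" where
  "jointly_linearly_convex X F DF \<longleftrightarrow>
     (\<forall>\<rho>\<in>UNIV \<rightarrow> ac_prob X. \<forall>\<rho>'\<in>UNIV \<rightarrow> ac_prob X.
        F \<rho>' \<ge> F \<rho> + (\<Sum>j\<in>UNIV. signed_integral (\<rho>' j) (\<rho> j) (DF j \<rho>)))"

text \<open>
  Weak convergence of probability measures on \<open>X\<close>. The library's \<open>weak_conv_m\<close> only covers measures
  on the real line.
\<close>

definition narrow_conv ::
  "'a::euclidean_space set \<Rightarrow> (nat \<Rightarrow> 'a measure) \<Rightarrow> 'a measure \<Rightarrow> bool" where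
  "narrow_conv X \<mu>s \<mu> \<longleftrightarrow>
     (\<forall>f :: 'a \<Rightarrow> real. continuous_on X f \<and> bounded (f ` X) \<longrightarrow>
        (\<lambda>n. integral\<^sup>L (\<mu>s n) f) \<longlonglongrightarrow> integral\<^sup>L \<mu> f)"

text \<open>
  The narrow topology is metrizable, so sequences suffice.
\<close>

definition narrow_lsc ::
  "'a::euclidean_space set \<Rightarrow> (('m::finite \<Rightarrow> 'a measure) \<Rightarrow> real) \<Rightarrow> bool" where
  "narrow_lsc X F \<longleftrightarrow>
     (\<forall>\<rho>s \<rho>. (\<forall>n. \<rho>s n \<in> UNIV \<rightarrow> ac_prob X) \<and> \<rho> \<in> UNIV \<rightarrow> ac_prob X \<and>
        (\<forall>j. narrow_conv X (\<lambda>n. \<rho>s n j) (\<rho> j)) \<longrightarrow>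
        ereal (F \<rho>) \<le> liminf (\<lambda>n. ereal (F (\<rho>s n))))"

end

theory Submission
  imports Defs
begin

text \<open>
  The minimiser of a mirror step is the Gibbs measure \<open>\<rho>\<^sub>j\<^sup>k \<propto> exp (- \<eta>\<^sub>k g) \<rho>\<^sub>j\<^sup>k\<^sup>-\<^sup>1\<close>, where \<open>g\<close> is the
  first variation at \<open>\<rho>\<^sup>k\<^sup>-\<^sup>1\<close>. Reading off log-densities, the divergence from any \<open>\<rho>\<^sub>j\<close> changes in this
  step by exactly \<open>\<eta>\<^sub>k \<integral> g d\<rho>\<^sub>j + ln Z\<close> with \<open>Z\<close> the normalising constant, and Hoeffding's lemma gives
  \<open>ln Z \<le> - \<eta>\<^sub>k \<integral> g d\<rho>\<^sub>j\<^sup>k\<^sup>-\<^sup>1 + \<eta>\<^sub>k\<^sup>2 L\<^sub>j\<^sup>2 / 2\<close>. Summing over \<open>j\<close>, joint convexity bounds the linear term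
  by \<open>\<eta>\<^sub>k (F \<rho> - F \<rho>\<^sup>k\<^sup>-\<^sup>1)\<close>; summing over \<open>k\<close> telescopes the divergences, the last of which is nonnegative.
\<close>

section \<open>Relative entropy\<close>

text \<open>With \<open>D\<close> a real-valued density of \<open>\<mu>\<close> against
  \<open>\<nu>\<close>, integrability of the log-density under \<open>\<mu>\<close> becomes
  integrability of \<open>D * log D\<close> under \<open>\<nu>\<close>, the form in which Gibbs'
  inequality applies.\<close>

lemma KL_nonneg:
  assumes "prob_space \<mu>" "prob_space \<nu>" "sets \<mu> = sets \<nu>"
  shows "0 \<le> KL \<mu> \<nu>"
proof (cases "absolutely_continuous \<nu> \<mu> \<and> integrable \<mu> (entropy_density (exp 1) \<nu> \<mu>)")
  case True
  interpret \<mu>: prob_space \<mu> by fact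
  interpret \<nu>: prob_space \<nu> by fact
  interpret information_space \<nu> "exp 1"
    by unfold_locales simp
  have "finite_measure \<mu>" by unfold_locales
  from \<nu>.real_RN_deriv[OF this] True assms(3) obtain D where D: "D \<in> borel_measurable \<nu>"
      "AE x in \<nu>. RN_deriv \<nu> \<mu> x = ennreal (D x)" "AE x in \<mu>. 0 < D x" "\<And>x. 0 \<le> D x"
    by metis
  have "\<mu> = density \<nu> (RN_deriv \<nu> \<mu>)"
    using True assms(3) by (simp add: \<nu>.density_RN_deriv)
  also have "\<dots> = density \<nu> D"
    using D by (auto intro!: density_cong)
  finally have \<mu>: "\<mu> = density \<nu> D" .
  have "AE x in \<mu>. RN_deriv \<nu> \<mu> x = ennreal (D x)"
    using True assms(3) D(2) absolutely_continuous_AE by blast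
  then have "AE x in \<mu>. entropy_density (exp 1) \<nu> \<mu> x = log (exp 1) (D x)"
    by eventually_elim (use D(4) in \<open>simp add: entropy_density_def\<close>)
  moreover have "(\<lambda>x. log (exp 1) (D x)) \<in> borel_measurable \<mu>"
    using D(1) by (simp add: measurable_cong_sets[OF assms(3) refl])
  ultimately have "integrable \<mu> (\<lambda>x. log (exp 1) (D x))"
    using integrable_cong_AE_imp True by blast
  then have "integrable \<nu> (\<lambda>x. D x * log (exp 1) (D x))"
    using D by (subst (asm) \<mu>) (simp add: integrable_density)
  then have "0 \<le> KL_divergence (exp 1) \<nu> \<mu>"
    unfolding \<mu> using D assms(1) by (intro KL_nonneg) (auto simp: \<mu>[symmetric])
  then show ?thesis
    using True by (simp add: KL_def)
qed (auto simp: KL_def)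

text \<open>The log-density of \<open>\<mu>\<close> against itself vanishes almost everywhere and so
  is integrable; this excludes the branch of \<open>KL\<close> with value
  \<open>\<infinity>\<close>.\<close>

lemma KL_self:
  assumes "prob_space \<mu>"
  shows "KL \<mu> \<mu> = 0"
proof -
  interpret prob_space \<mu> by fact
  have "AE x in \<mu>. 1 = RN_deriv \<mu> \<mu> x"
    by (rule RN_deriv_unique) (simp_all add: density_1)
  then have "AE x in \<mu>. 0 = entropy_density (exp 1) \<mu> \<mu> x"
    by eventually_elim (metis comp_apply enn2real_1 entropy_density_def log_one)
  then have "integrable \<mu> (entropy_density (exp 1) \<mu> \<mu>)"
    by (intro integrable_cong_AE_imp[OF integrable_zero]) auto
  then show ?thesis
    by (simp add: KL_def KL_same_eq_0 absolutely_continuous_def)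
qed

lemma KL_eq_0_imp_eq:
  assumes "prob_space \<mu>" "prob_space \<nu>" "sets \<mu> = sets \<nu>" "KL \<mu> \<nu> = 0"
  shows "\<mu> = \<nu>"
proof -
  interpret prob_space \<nu> by fact
  interpret information_space \<nu> "exp 1"
    by unfold_locales simp
  show ?thesis
    using assms KL_eq_0_iff_eq_ac[of \<mu>] by (auto simp: KL_def zero_ereal_def split: if_splits)
qed

section \<open>Exponential tilting\<close>

text \<open>An exponential density vanishes nowhere. Hence absolute continuity with respect to a
  measure and with respect to its tilt are the same condition.\<close>

lemma null_sets_density_exp:
  fixes h :: "'a \<Rightarrow> real"
  assumes "h \<in> borel_measurable \<mu>"
  shows "null_sets (density \<mu> (\<lambda>x. exp (h x))) = null_sets \<mu>"
proof -
  have "(\<lambda>x. ennreal (exp (h x))) \<in> borel_measurable \<mu>"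
    using assms by measurable
  then have "A \<in> null_sets (density \<mu> (\<lambda>x. exp (h x))) \<longleftrightarrow> A \<in> null_sets \<mu>" for A
    by (auto simp: null_sets_density_iff ennreal_eq_0_iff not_le AE_iff_null_sets[symmetric]
        intro: AE_not_in)
  then show ?thesis
    by blast
qed

text \<open>Chain rule: the density of \<open>\<sigma>\<close> against the tilt is
  \<open>exp (- h x)\<close> times its density against \<open>\<mu>\<close>, so the log-densities
  differ by \<open>h\<close>. As \<open>h\<close> is \<open>\<sigma>\<close>-integrable, both
  divergences are infinite together and the identity holds in \<open>ereal\<close>.\<close>

lemma KL_density_exp:
  fixes h :: "'a \<Rightarrow> real"
  assumes "sigma_finite_measure \<mu>" "sigma_finite_measure \<sigma>" "sets \<sigma> = sets \<mu>"
    and h: "h \<in> borel_measurable \<mu>" "integrable \<sigma> h"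
  shows "KL \<sigma> (density \<mu> (\<lambda>x. exp (h x))) = KL \<sigma> \<mu> - ereal (\<integral>x. h x \<partial>\<sigma>)"
proof (cases "absolutely_continuous \<mu> \<sigma>")
  case True
  define \<nu> where "\<nu> = density \<mu> (\<lambda>x. exp (h x))"
  note [measurable] = h(1)
  have [measurable]: "h \<in> borel_measurable \<sigma>"
    using h(2) by simp
  have sets_\<nu>: "sets \<nu> = sets \<mu>"
    by (simp add: \<nu>_def)
  interpret \<mu>: sigma_finite_measure \<mu> by fact
  interpret \<sigma>: sigma_finite_measure \<sigma> by fact
  interpret \<nu>: sigma_finite_measure \<nu>
    unfolding \<nu>_def by (subst \<mu>.sigma_finite_iff_density_finite) auto
  have "null_sets \<mu> = null_sets \<nu>"
    using null_sets_density_exp[OF h(1)] by (simp add: \<nu>_def)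
  then have ac: "absolutely_continuous \<nu> \<sigma>"
    using True by (simp add: absolutely_continuous_def)
  define D where "D = RN_deriv \<mu> \<sigma>"
  have [measurable]: "D \<in> borel_measurable \<mu>"
    by (simp add: D_def)
  have dens: "density \<mu> D = \<sigma>"
    unfolding D_def using True assms(3) by (rule \<mu>.density_RN_deriv)
  have "density \<nu> (\<lambda>x. ennreal (exp (- h x)) * D x) =
      density \<mu> (\<lambda>x. ennreal (exp (h x)) * (ennreal (exp (- h x)) * D x))"
    unfolding \<nu>_def by (subst density_density_eq) auto
  also have "\<dots> = density \<mu> D"
    by (intro density_cong) (auto simp: mult.assoc[symmetric] ennreal_mult[symmetric] exp_minus)
  finally have "density \<nu> (\<lambda>x. ennreal (exp (- h x)) * D x) = \<sigma>"
    by (simp add: dens)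
  then have "AE x in \<nu>. ennreal (exp (- h x)) * D x = RN_deriv \<nu> \<sigma> x"
    by (intro \<nu>.RN_deriv_unique) (auto simp: \<nu>_def)
  then have 1: "AE x in \<sigma>. ennreal (exp (- h x)) * D x = RN_deriv \<nu> \<sigma> x"
    using absolutely_continuous_AE[of \<sigma> \<nu>] ac assms(3) by (auto simp: \<nu>_def)
  \<comment> \<open>The real logarithm of \<open>exp (- h x) * D x\<close> is split where
    \<open>D\<close> is finite and positive; both exceptional sets are
    \<open>\<sigma>\<close>-null.\<close>
  have "AE x in \<mu>. D x \<noteq> \<infinity>"
    unfolding D_def using True assms(2,3) by (intro \<mu>.RN_deriv_finite)
  then have 2: "AE x in \<sigma>. D x \<noteq> \<infinity>"
    using absolutely_continuous_AE[of \<sigma> \<mu>] True assms(3) by blast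
  have 3: "AE x in \<sigma>. 0 < D x"
    by (subst dens[symmetric]) (simp add: AE_density)
  from 1 2 3 have eq: "AE x in \<sigma>.
      entropy_density (exp 1) \<nu> \<sigma> x = entropy_density (exp 1) \<mu> \<sigma> x - h x"
  proof eventually_elim
    case (elim x)
    then have "0 < enn2real (D x)"
      by (auto simp: enn2real_positive_iff less_top)
    moreover have "enn2real (RN_deriv \<nu> \<sigma> x) = exp (- h x) * enn2real (D x)"
      by (simp add: elim(1)[symmetric] enn2real_mult)
    ultimately show ?case
      by (simp add: entropy_density_def D_def log_def ln_mult)
  qed
  have [measurable]: "entropy_density (exp 1) \<nu> \<sigma> \<in> borel_measurable \<sigma>"
      "entropy_density (exp 1) \<mu> \<sigma> \<in> borel_measurable \<sigma>"
    using assms(3) sets_\<nu> measurable_entropy_density by (metis measurable_cong_sets)+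
  have "integrable \<sigma> (entropy_density (exp 1) \<nu> \<sigma>) \<longleftrightarrow>
      integrable \<sigma> (\<lambda>x. entropy_density (exp 1) \<mu> \<sigma> x - h x)"
    using eq by (intro integrable_cong_AE) auto
  also have "\<dots> \<longleftrightarrow> integrable \<sigma> (entropy_density (exp 1) \<mu> \<sigma>)"
    using h(2) Bochner_Integration.integrable_add[of \<sigma> "\<lambda>x. entropy_density (exp 1) \<mu> \<sigma> x - h x" h]
    by auto
  finally have int: "integrable \<sigma> (entropy_density (exp 1) \<nu> \<sigma>) \<longleftrightarrow>
      integrable \<sigma> (entropy_density (exp 1) \<mu> \<sigma>)" .
  have "KL_divergence (exp 1) \<nu> \<sigma> = (\<integral>x. entropy_density (exp 1) \<mu> \<sigma> x - h x \<partial>\<sigma>)"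
    unfolding KL_divergence_def using eq by (intro integral_cong_AE) auto
  then have "KL \<sigma> \<nu> = KL \<sigma> \<mu> - ereal (\<integral>x. h x \<partial>\<sigma>)"
    using int True ac h(2) by (auto simp: KL_def KL_divergence_def)
  then show ?thesis
    by (simp add: \<nu>_def)
next
  case False
  then show ?thesis
    by (simp add: KL_def absolutely_continuous_def null_sets_density_exp[OF h(1)])
qed

section \<open>Gibbs measures\<close>

definition log_partition :: "real \<Rightarrow> ('a \<Rightarrow> real) \<Rightarrow> 'a measure \<Rightarrow> real" where
  "log_partition \<eta> g \<mu> = ln (\<integral>x. exp (- \<eta> * g x) \<partial>\<mu>)"

text \<open>The normalising constant sits in the exponent, which makes this an exponential tilt in
  the sense of \<open>KL_density_exp\<close>.\<close>

definition gibbs :: "real \<Rightarrow> ('a \<Rightarrow> real) \<Rightarrow> 'a measure \<Rightarrow> 'a measure" where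
  "gibbs \<eta> g \<mu> = density \<mu> (\<lambda>x. exp (- \<eta> * g x - log_partition \<eta> g \<mu>))"

lemma sets_gibbs [simp]: "sets (gibbs \<eta> g \<mu>) = sets \<mu>"
  by (simp add: gibbs_def)

lemma (in prob_space) integral_exp_pos:
  fixes f :: "'a \<Rightarrow> real"
  assumes "integrable M (\<lambda>x. exp (f x))"
  shows "0 < (\<integral>x. exp (f x) \<partial>M)"
proof -
  have "(\<integral>x. 0 \<partial>M) < (\<integral>x. exp (f x) \<partial>M)"
    using assms emeasure_space_1 by (intro integral_less_AE_space) auto
  then show ?thesis
    by simp
qed

text \<open>One coordinate of one step. The bound is almost everywhere because it comes from an
  essential supremum.\<close>

locale bounded_potential = prob_space \<mu> for \<mu> :: "'a measure" +
  fixes g :: "'a \<Rightarrow> real" and L \<eta> :: real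
  assumes potential [measurable]: "g \<in> borel_measurable \<mu>"
    and bounded: "AE x in \<mu>. \<bar>g x\<bar> \<le> L"
    and step_pos: "0 < \<eta>"
begin

lemma integrable_exp_potential: "integrable \<mu> (\<lambda>x. exp (- \<eta> * g x))"
proof (rule integrable_const_bound)
  show "AE x in \<mu>. norm (exp (- \<eta> * g x)) \<le> exp (\<eta> * L)"
    using bounded
  proof eventually_elim
    case (elim x)
    have "\<eta> * - L \<le> \<eta> * g x"
      using elim step_pos by (intro mult_left_mono) auto
    then show ?case by simp
  qed
qed simp

lemma partition_pos: "0 < (\<integral>x. exp (- \<eta> * g x) \<partial>\<mu>)"
  using integrable_exp_potential by (rule integral_exp_pos)

lemma prob_space_gibbs: "prob_space (gibbs \<eta> g \<mu>)"
proof (rule prob_spaceI)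
  let ?h = "\<lambda>x. exp (- \<eta> * g x - log_partition \<eta> g \<mu>)"
  have h: "?h = (\<lambda>x. exp (- \<eta> * g x) / (\<integral>x. exp (- \<eta> * g x) \<partial>\<mu>))"
    using partition_pos by (simp add: exp_diff log_partition_def)
  have "integrable \<mu> ?h"
    unfolding h using integrable_exp_potential by simp
  moreover have "integral\<^sup>L \<mu> ?h = 1"
    unfolding h using partition_pos by simp
  ultimately show "emeasure (gibbs \<eta> g \<mu>) (space (gibbs \<eta> g \<mu>)) = 1"
    by (simp add: gibbs_def emeasure_density nn_integral_eq_integral cong: nn_integral_cong)
qed

lemma absolutely_continuous_gibbs: "absolutely_continuous \<mu> (gibbs \<eta> g \<mu>)"
  unfolding gibbs_def by (rule absolutely_continuousI_density) simp

text \<open>The right-hand side is \<open>\<eta>\<close> times the mirror-step objective at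
  \<open>\<sigma>\<close> plus a constant independent of \<open>\<sigma>\<close>. This is
  \<open>KL_density_exp\<close>; \<open>\<sigma>\<close> has mass \<open>1\<close>, so the
  log-partition term integrates to itself.\<close>

lemma KL_gibbs:
  assumes "prob_space \<sigma>" "sets \<sigma> = sets \<mu>" "integrable \<sigma> g"
  shows "KL \<sigma> (gibbs \<eta> g \<mu>) =
    KL \<sigma> \<mu> + ereal (\<eta> * (\<integral>x. g x \<partial>\<sigma>) + log_partition \<eta> g \<mu>)"
proof -
  interpret \<sigma>: prob_space \<sigma> by fact
  have "KL \<sigma> (gibbs \<eta> g \<mu>) =
      KL \<sigma> \<mu> - ereal (\<integral>x. - \<eta> * g x - log_partition \<eta> g \<mu> \<partial>\<sigma>)"
    unfolding gibbs_def using assms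
    by (intro KL_density_exp)
       (auto intro: sigma_finite_measure_axioms \<sigma>.sigma_finite_measure_axioms)
  also have "(\<integral>x. - \<eta> * g x - log_partition \<eta> g \<mu> \<partial>\<sigma>) =
      - (\<eta> * (\<integral>x. g x \<partial>\<sigma>) + log_partition \<eta> g \<mu>)"
    using assms(3) by (simp add: \<sigma>.prob_space)
  finally show ?thesis
    by (simp only: minus_ereal_def uminus_ereal.simps minus_minus)
qed

text \<open>Hoeffding's lemma for \<open>- g\<close>, whose values lie in an interval of length
  \<open>2 * L\<close>; this gives the constant
  \<open>(2 * L)\<^sup>2 / 8 = L\<^sup>2 / 2\<close>.\<close>

lemma log_partition_le: "log_partition \<eta> g \<mu> \<le> - \<eta> * (\<integral>x. g x \<partial>\<mu>) + \<eta>\<^sup>2 * L\<^sup>2 / 2"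
proof -
  interpret interval_bounded_random_variable \<mu> "\<lambda>x. - g x" "- L" L
    by unfold_locales (use bounded in \<open>auto elim!: eventually_mono\<close>)
  let ?m = "\<integral>x. g x \<partial>\<mu>"
  \<comment> \<open>Factoring out the mean leaves the moment generating function of a centred
    variable: \<open>- - ?m\<close> subtracts the mean \<open>- ?m\<close> of
    \<open>- g\<close>.\<close>
  have "(\<integral>x. exp (- \<eta> * g x) \<partial>\<mu>) = exp (- \<eta> * ?m) * (\<integral>x. exp (\<eta> * (- g x - - ?m)) \<partial>\<mu>)"
    by (subst integral_mult_right_zero[symmetric])
       (simp add: exp_add[symmetric] algebra_simps)
  also have "(\<integral>x. exp (\<eta> * (- g x - - ?m)) \<partial>\<mu>) \<le> exp (\<eta>\<^sup>2 * (L - - L)\<^sup>2 / 8)"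
  proof -
    have "integrable \<mu> (\<lambda>x. exp (\<eta> * (- g x - - ?m)))"
      using integrable_mult_right[OF integrable_exp_potential, of "exp (\<eta> * ?m)"]
      by (simp add: exp_add[symmetric] algebra_simps)
    then have "ennreal (\<integral>x. exp (\<eta> * (- g x - - ?m)) \<partial>\<mu>) =
        (\<integral>\<^sup>+x. exp (\<eta> * (- g x - - ?m)) \<partial>\<mu>)"
      by (subst nn_integral_eq_integral) auto
    also have "\<dots> \<le> ennreal (exp (\<eta>\<^sup>2 * (L - - L)\<^sup>2 / 8))"
      using Hoeffdings_lemma_nn_integral[OF step_pos] by simp
    finally show ?thesis
      by simp
  qed
  also have "\<eta>\<^sup>2 * (L - - L)\<^sup>2 / 8 = \<eta>\<^sup>2 * L\<^sup>2 / 2"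
    by (simp add: power2_eq_square)
  finally have "(\<integral>x. exp (- \<eta> * g x) \<partial>\<mu>) \<le> exp (- \<eta> * ?m) * exp (\<eta>\<^sup>2 * L\<^sup>2 / 2)"
    by simp
  then have "(\<integral>x. exp (- \<eta> * g x) \<partial>\<mu>) \<le> exp (- \<eta> * ?m + \<eta>\<^sup>2 * L\<^sup>2 / 2)"
    by (simp only: exp_add)
  then show ?thesis
    unfolding log_partition_def using partition_pos ln_le_cancel_iff[OF _ exp_gt_zero] by (metis ln_exp)
qed

text \<open>Hoeffding's bound supplies the \<open>\<mu>\<close>-part of the signed integral, at the
  cost of the quadratic term.\<close>

lemma KL_gibbs_le:
  assumes "prob_space \<sigma>" "sets \<sigma> = sets \<mu>" "integrable \<sigma> g"
  shows "KL \<sigma> (gibbs \<eta> g \<mu>) \<le>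
    KL \<sigma> \<mu> + ereal (\<eta> * signed_integral \<sigma> \<mu> g + \<eta>\<^sup>2 * L\<^sup>2 / 2)"
  unfolding KL_gibbs[OF assms] using log_partition_le
  by (intro add_left_mono) (simp add: signed_integral_def right_diff_distrib)

text \<open>By \<open>KL_gibbs\<close>, the objective and the divergence to the Gibbs measure order
  competitors alike. A \<open>\<sigma>\<close> no worse than the Gibbs measure is therefore at
  divergence at most \<open>0\<close> from it, the divergence of the Gibbs measure from
  itself.\<close>

lemma mirror_step_eq_gibbs:
  assumes \<sigma>: "prob_space \<sigma>" "sets \<sigma> = sets \<mu>" "integrable \<sigma> g"
    and \<nu>: "integrable (gibbs \<eta> g \<mu>) g"
    and le: "ereal (signed_integral \<sigma> \<mu> g) + ereal (1 / \<eta>) * KL \<sigma> \<mu> \<le>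
      ereal (signed_integral (gibbs \<eta> g \<mu>) \<mu> g) + ereal (1 / \<eta>) * KL (gibbs \<eta> g \<mu>) \<mu>"
  shows "\<sigma> = gibbs \<eta> g \<mu>"
proof (rule KL_eq_0_imp_eq)
  let ?\<nu> = "gibbs \<eta> g \<mu>" and ?Z = "log_partition \<eta> g \<mu>"
  \<comment> \<open>\<open>KL_gibbs\<close> is applied to the Gibbs measure itself, which shows that
    \<open>KL ?\<nu> \<mu>\<close> is finite and gives its value.\<close>
  have "0 = KL ?\<nu> \<mu> + ereal (\<eta> * (\<integral>x. g x \<partial>?\<nu>) + ?Z)"
    using KL_gibbs[of ?\<nu>] KL_self[OF prob_space_gibbs] prob_space_gibbs \<nu> by simp
  then obtain v where v: "KL ?\<nu> \<mu> = ereal v" "v = - (\<eta> * (\<integral>x. g x \<partial>?\<nu>) + ?Z)"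
    by (cases "KL ?\<nu> \<mu>") (auto simp: zero_ereal_def)
  \<comment> \<open>The objective is finite at the Gibbs measure, hence also at
    \<open>\<sigma>\<close>, and the comparison reduces to real arithmetic.\<close>
  have "KL \<sigma> \<mu> \<noteq> \<infinity>"
    using le v step_pos by auto
  moreover have "0 \<le> KL \<sigma> \<mu>"
    using \<sigma> by (intro KL_nonneg) (auto intro: prob_space_axioms)
  ultimately obtain u where u: "KL \<sigma> \<mu> = ereal u"
    by (cases "KL \<sigma> \<mu>") auto
  have "(\<integral>x. g x \<partial>\<sigma>) + u / \<eta> \<le> (\<integral>x. g x \<partial>?\<nu>) + v / \<eta>"
    using le u v(1) by (simp add: signed_integral_def)
  then have "\<eta> * (\<integral>x. g x \<partial>\<sigma>) + u \<le> \<eta> * (\<integral>x. g x \<partial>?\<nu>) + v"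
    using mult_left_mono[of _ _ \<eta>] step_pos by (fastforce simp: distrib_left)
  then have "KL \<sigma> ?\<nu> \<le> 0"
    using v(2) u KL_gibbs[OF \<sigma>] by (simp add: zero_ereal_def)
  moreover have "0 \<le> KL \<sigma> ?\<nu>"
    using \<sigma> prob_space_gibbs by (intro KL_nonneg) auto
  ultimately show "KL \<sigma> ?\<nu> = 0"
    by simp
qed (use \<sigma> prob_space_gibbs in auto)

end

section \<open>One step of mirror descent on \<open>X\<close>\<close>

lemma ac_probD:
  assumes "\<mu> \<in> ac_prob X"
  shows "prob_space \<mu>" "sets \<mu> = sets (restrict_space borel X)"
    "absolutely_continuous (restrict_space lborel X) \<mu>"
  using assms by (auto simp: ac_prob_def)

lemma AE_ac_prob:
  assumes "\<mu> \<in> ac_prob X" "AE x in restrict_space lborel X. P x"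
  shows "AE x in \<mu>. P x"
proof (rule absolutely_continuous_AE)
  show "sets \<mu> = sets (restrict_space lborel X)"
    using ac_probD(2)[OF assms(1)] by (simp add: sets_restrict_space)
qed (use assms ac_probD in auto)

lemma KL_mirror_descent_step:
  assumes \<mu>: "\<mu> \<in> ac_prob X" and \<sigma>: "\<sigma> \<in> ac_prob X" and "0 < \<eta>"
    and int: "\<And>\<nu>. \<nu> \<in> ac_prob X \<Longrightarrow> integrable \<nu> g"
    and bound: "AE x in restrict_space lborel X. \<bar>g x\<bar> \<le> L"
    and argmin: "is_arg_min (\<lambda>\<nu>. ereal (signed_integral \<nu> \<mu> g) + ereal (1 / \<eta>) * KL \<nu> \<mu>)
      (\<lambda>\<nu>. \<nu> \<in> ac_prob X) \<mu>'"
  shows "KL \<sigma> \<mu>' \<le> KL \<sigma> \<mu> + ereal (\<eta> * signed_integral \<sigma> \<mu> g + \<eta>\<^sup>2 * L\<^sup>2 / 2)"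
proof -
  interpret bounded_potential \<mu> g L \<eta>
  proof (intro bounded_potential.intro bounded_potential_axioms.intro)
    show "g \<in> borel_measurable \<mu>"
      using int[OF \<mu>] by simp
    show "AE x in \<mu>. \<bar>g x\<bar> \<le> L"
      using \<mu> bound by (rule AE_ac_prob)
  qed (use ac_probD[OF \<mu>] \<open>0 < \<eta>\<close> in auto)
  \<comment> \<open>The Gibbs measure has to be an admissible competitor; absolute continuity passes
    from Lebesgue measure through \<open>\<mu>\<close> to it.\<close>
  have "absolutely_continuous (restrict_space lborel X) (gibbs \<eta> g \<mu>)"
    using ac_probD(3)[OF \<mu>] absolutely_continuous_gibbs
    unfolding absolutely_continuous_def by blast
  then have \<nu>: "gibbs \<eta> g \<mu> \<in> ac_prob X"
    using ac_probD[OF \<mu>] prob_space_gibbs by (simp add: ac_prob_def)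
  have \<mu>': "\<mu>' \<in> ac_prob X"
    using argmin by (simp add: is_arg_min_def)
  have "\<mu>' = gibbs \<eta> g \<mu>"
    using argmin \<nu> ac_probD[OF \<mu>'] ac_probD[OF \<mu>] int[OF \<mu>'] int[OF \<nu>]
    by (intro mirror_step_eq_gibbs) (auto simp: is_arg_min_def not_less)
  then show ?thesis
    using KL_gibbs_le[of \<sigma>] ac_probD[OF \<sigma>] ac_probD[OF \<mu>] int[OF \<sigma>] by simp
qed

section \<open>Convergence rate\<close>

theorem theorem5:
  fixes X :: "'a::euclidean_space set"
    and F :: "('m::finite \<Rightarrow> 'a measure) \<Rightarrow> real"
    and DF :: "'m \<Rightarrow> ('m \<Rightarrow> 'a measure) \<Rightarrow> 'a \<Rightarrow> real"
    and \<rho>s :: "nat \<Rightarrow> 'm \<Rightarrow> 'a measure"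
    and \<rho> :: "'m \<Rightarrow> 'a measure"
    and \<eta> :: "nat \<Rightarrow> real"
    and L :: "'m \<Rightarrow> real"
    and K :: nat
  assumes "X \<in> sets borel"
    and "narrow_lsc X F"
    and "\<And>j \<sigma>. \<sigma> \<in> UNIV \<rightarrow> ac_prob X \<Longrightarrow> is_first_variation X F j \<sigma> (DF j \<sigma>)"
    and "jointly_linearly_convex X F DF"
    and "K \<ge> 1"
    and "\<And>k. k \<in> {1..K} \<Longrightarrow> \<eta> k > 0"
    and "\<rho>s 0 \<in> UNIV \<rightarrow> ac_prob X"
    and "\<And>k j. k \<in> {1..K} \<Longrightarrow>
           is_arg_min
             (\<lambda>\<mu>. ereal (signed_integral \<mu> (\<rho>s (k - 1) j) (DF j (\<rho>s (k - 1))))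
                   + ereal (1 / \<eta> k) * KL \<mu> (\<rho>s (k - 1) j))
             (\<lambda>\<mu>. \<mu> \<in> ac_prob X)
             (\<rho>s k j)"
    and "\<And>j. L j \<ge> 0"
    and "\<And>j. (SUP \<sigma>\<in>UNIV \<rightarrow> ac_prob X.
                esssup (restrict_space lborel X) (\<lambda>x. ereal \<bar>DF j \<sigma> x\<bar>)) \<le> ereal (L j)"
    and "\<rho> \<in> UNIV \<rightarrow> ac_prob2 X"
  shows "ereal (Min ((\<lambda>k. F (\<rho>s k)) ` {0..K - 1}) - F \<rho>)
           \<le> KL_tuple \<rho> (\<rho>s 0) / ereal (\<Sum>k=1..K. \<eta> k)
             + ereal ((\<Sum>k=1..K. (\<eta> k)\<^sup>2 * (\<Sum>j\<in>UNIV. (L j)\<^sup>2)) / (2 * (\<Sum>k=1..K. \<eta> k)))"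
proof -
  note fv = assms(3) and convex = assms(4) and K = assms(5) and \<eta> = assms(6)
    and argmin = assms(8) and esssup = assms(10)
  have ac: "\<rho>s k j \<in> ac_prob X" if "k \<le> K" for k j
    using that assms(7) argmin[of k j] by (cases "k = 0") (auto simp: is_arg_min_def)
  have \<rho>: "\<rho> j \<in> ac_prob X" for j
    using assms(11) by (auto simp: ac_prob2_def)
  define C where "C = (\<Sum>j\<in>UNIV. (L j)\<^sup>2)"
  define S where "S = (\<Sum>k=1..K. \<eta> k)"
  define m where "m = Min ((\<lambda>k. F (\<rho>s k)) ` {0..K - 1})"
  have S: "0 < S"
    unfolding S_def using \<eta> K by (intro sum_pos) auto

  \<comment> \<open>Divergences may be infinite, so they are never subtracted: each stays on its own
    side of the inequality.\<close>
  have step: "KL_tuple \<rho> (\<rho>s k) + ereal (\<eta> k * (F (\<rho>s (k - 1)) - F \<rho>)) \<le>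
      KL_tuple \<rho> (\<rho>s (k - 1)) + ereal ((\<eta> k)\<^sup>2 * C / 2)" if k: "k \<in> {1..K}" for k
  proof -
    let ?\<mu> = "\<rho>s (k - 1)"
    let ?s = "\<lambda>j. signed_integral (\<rho> j) (?\<mu> j) (DF j ?\<mu>)"
    have \<mu>: "?\<mu> \<in> UNIV \<rightarrow> ac_prob X"
      using ac k by auto
    have "KL (\<rho> j) (\<rho>s k j) \<le>
        KL (\<rho> j) (?\<mu> j) + ereal (\<eta> k * ?s j + (\<eta> k)\<^sup>2 * (L j)\<^sup>2 / 2)" for j
    proof (rule KL_mirror_descent_step)
      have "esssup (restrict_space lborel X) (\<lambda>x. ereal \<bar>DF j ?\<mu> x\<bar>) \<le> ereal (L j)"
        using \<mu> by (intro order_trans[OF SUP_upper esssup])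
      then show "AE x in restrict_space lborel X. \<bar>DF j ?\<mu> x\<bar> \<le> L j"
        using esssup_AE[of "\<lambda>x. ereal \<bar>DF j ?\<mu> x\<bar>" "restrict_space lborel X"]
        by (elim eventually_mono) (use order_trans in force)
      show "integrable \<nu> (DF j ?\<mu>)" if "\<nu> \<in> ac_prob X" for \<nu>
        using fv[OF \<mu>] that by (auto simp: is_first_variation_def)
    qed (use \<mu> \<rho> \<eta> k argmin in auto)
    then have "KL_tuple \<rho> (\<rho>s k) \<le>
        (\<Sum>j\<in>UNIV. KL (\<rho> j) (?\<mu> j) + ereal (\<eta> k * ?s j + (\<eta> k)\<^sup>2 * (L j)\<^sup>2 / 2))"
      unfolding KL_tuple_def by (intro sum_mono)
    also have "\<dots> = KL_tuple \<rho> ?\<mu> + ereal (\<eta> k * (\<Sum>j\<in>UNIV. ?s j) + (\<eta> k)\<^sup>2 * C / 2)"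
      by (simp add: KL_tuple_def C_def sum.distrib sum_distrib_left sum_divide_distrib)
    finally have *: "KL_tuple \<rho> (\<rho>s k) \<le>
        KL_tuple \<rho> ?\<mu> + ereal (\<eta> k * (\<Sum>j\<in>UNIV. ?s j) + (\<eta> k)\<^sup>2 * C / 2)" .
    \<comment> \<open>Since all coordinates move in parallel, every first variation is taken at the
      same \<open>?\<mu>\<close>, and the integrals add up to the linear term of joint convexity
      from \<open>?\<mu>\<close> to \<open>\<rho>\<close>.\<close>
    have "F ?\<mu> + (\<Sum>j\<in>UNIV. ?s j) \<le> F \<rho>"
      using convex \<mu> \<rho> by (auto simp: jointly_linearly_convex_def)
    then have "\<eta> k * (\<Sum>j\<in>UNIV. ?s j) \<le> \<eta> k * (F \<rho> - F ?\<mu>)"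
      using \<eta>[OF k] by (intro mult_left_mono) auto
    then have "\<eta> k * (\<Sum>j\<in>UNIV. ?s j) + (\<eta> k)\<^sup>2 * C / 2 + \<eta> k * (F ?\<mu> - F \<rho>) \<le> (\<eta> k)\<^sup>2 * C / 2"
      by (simp add: algebra_simps)
    then show ?thesis
      using * by (cases "KL_tuple \<rho> (\<rho>s k)"; cases "KL_tuple \<rho> ?\<mu>") auto
  qed

  \<comment> \<open>If the initial divergence is infinite, the bound is trivial; otherwise no later
    one is infinite, and the intermediate ones cancel.\<close>
  have telescope: "KL_tuple \<rho> (\<rho>s n) + ereal (\<Sum>k=1..n. \<eta> k * (F (\<rho>s (k - 1)) - F \<rho>)) \<le>
      KL_tuple \<rho> (\<rho>s 0) + ereal (\<Sum>k=1..n. (\<eta> k)\<^sup>2 * C / 2)" if "n \<le> K" for n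
    using that
  proof (induction n)
    case (Suc n)
    then show ?case
      using step[of "Suc n"]
      by (cases "KL_tuple \<rho> (\<rho>s n)"; cases "KL_tuple \<rho> (\<rho>s (Suc n))"; cases "KL_tuple \<rho> (\<rho>s 0)") auto
  qed simp

  have nonneg: "0 \<le> KL_tuple \<rho> (\<rho>s K)"
    unfolding KL_tuple_def using ac[OF order_refl] \<rho>
    by (intro sum_nonneg KL_nonneg) (simp_all add: ac_probD(1,2)[where X = X])
  \<comment> \<open>The weight \<open>\<eta> k\<close> belongs to the value of \<open>F\<close>
    before update \<open>k\<close>, at index \<open>k - 1\<close>; this is why the minimum runs over
    \<open>0..K - 1\<close>.\<close>
  have "S * (m - F \<rho>) = (\<Sum>k=1..K. \<eta> k * (m - F \<rho>))"
    by (simp add: S_def sum_distrib_right)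
  also have "\<dots> \<le> (\<Sum>k=1..K. \<eta> k * (F (\<rho>s (k - 1)) - F \<rho>))"
  proof (intro sum_mono mult_left_mono diff_right_mono)
    show "m \<le> F (\<rho>s (k - 1))" if "k \<in> {1..K}" for k
      unfolding m_def using that by (intro Min_le) auto
    show "0 \<le> \<eta> k" if "k \<in> {1..K}" for k
      using \<eta>[OF that] by simp
  qed
  finally have "ereal (S * (m - F \<rho>)) \<le> ereal (\<Sum>k=1..K. \<eta> k * (F (\<rho>s (k - 1)) - F \<rho>))"
    by simp
  also have "\<dots> \<le> KL_tuple \<rho> (\<rho>s K) + ereal (\<Sum>k=1..K. \<eta> k * (F (\<rho>s (k - 1)) - F \<rho>))"
    using nonneg by (cases "KL_tuple \<rho> (\<rho>s K)") auto
  also have "\<dots> \<le> KL_tuple \<rho> (\<rho>s 0) + ereal (\<Sum>k=1..K. (\<eta> k)\<^sup>2 * C / 2)"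
    by (rule telescope) simp
  finally have "ereal (S * (m - F \<rho>)) \<le> KL_tuple \<rho> (\<rho>s 0) + ereal ((\<Sum>k=1..K. (\<eta> k)\<^sup>2 * C) / 2)"
    by (simp add: sum_divide_distrib)
  \<comment> \<open>Dividing by \<open>S > 0\<close> is also sound for an infinite initial
    divergence, where the right-hand side is \<open>\<infinity>\<close>.\<close>
  then have "ereal (m - F \<rho>) \<le>
      KL_tuple \<rho> (\<rho>s 0) / ereal S + ereal ((\<Sum>k=1..K. (\<eta> k)\<^sup>2 * C) / (2 * S))"
    using S by (cases "KL_tuple \<rho> (\<rho>s 0)") (auto simp: field_simps)
  then show ?thesis
    by (simp only: m_def S_def C_def)
qed

end
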